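(* Let $\mathbf D^\pm_{ec}$ be consistent entropy conservative fluctuation fluxes for the Baer–Nunziato model (see context). For $\mathbf u^\pm\in\Omega$ and each phase $i=1,2$ let $k_{22},k_{32},k_{33},k_{42},k_{43},k_{44}$ be real coefficients (which may depend on $i$ and on $\mathbf u^\pm$) satisfying $$k_{22}\ge0,\quad k_{33}\ge0,\quad k_{44}\ge0,\quad k_{32}=\overline{u_i}\,k_{22},\quad k_{43}=\overline{u_i}\,k_{33},\quad k_{42}=\Big(\frac{C_{v,i}}{\hat\theta_i}+\frac{u_i^-u_i^+}2\Big)k_{22},$$ and define, with the vector convention of the context, $$\mathbf D_\nu(\mathbf u^-,\mathbf u^+)=\begin{pmatrix}0&0&0&0\\0&k_{22}&0&0\\0&k_{32}&k_{33}&0\\0&k_{42}&k_{43}&k_{44}\end{pmatrix}\begin{pmatrix}0\\ [\![\rho_i]\!]\\ [\![u_i]\!]\\ [\![T_i]\!]\end{pmatrix}.$$ Then $\mathbf D_\nu(\mathbf u,\mathbf u)=0$ and $[\![\mathbf v(\mathbf u)]\!]^\top\mathbf D_\nu(\mathbf u^-,\mathbf u^+)\ge0$ for all $\mathbf u,\mathbf u^\pm\in\Omega$; that is, $\mathbf D^\pm=\mathbf D^\pm_{ec}\pm\mathbf D_\nu$ are entropy stable fluxes.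
   Context: **Model.** Fix constants $C_{v,i}>0$, $\gamma_i>1$, $p_{\infty,i}\ge0$ ($i=1,2$) and $\chi\in\{0,\frac12,1\}$. The unknown is $$\mathbf u=(\alpha_1,\ \alpha_1\rho_1,\ \alpha_1\rho_1u_1,\ \alpha_1\rho_1E_1,\ \alpha_2\rho_2,\ \alpha_2\rho_2u_2,\ \alpha_2\rho_2E_2)^\top\in\mathbb R^7,\qquad \alpha_2=1-\alpha_1,$$ with void fractions $\alpha_i$, densities $\rho_i$, velocities $u_i$, specific total energies $E_i=e_i+u_i^2/2$. Pressure: $p_i=(\gamma_i-1)\rho_ie_i-\gamma_ip_{\infty,i}$. Temperature $T_i$ is defined by $\rho_ie_i=\rho_iC_{v,i}T_i+p_{\infty,i}$, and $\theta_i=1/T_i$. The phase space $\Omega$ is the set of $\mathbf u$ with $0<\alpha_i<1$, $\rho_i>0$, $u_i\in\mathbb R$, $e_i>0$ and $T_i>0$, $i=1,2$. **Vector convention.** A column $(a_i,b_i,c_i,d_i)^\top$, $i=1,2$, denotes the vector $(a_1,b_1,c_1,d_1,b_2,c_2,d_2)^\top\in\mathbb R^7$ (the first line corresponds to the void fraction equation, written for phase 1 only; the others to mass, momentum and energy of phase $i$). Thus the displayed $4\times4$ product is formed for each phase $i$. **System.** $\partial_t\mathbf u+\partial_x\mathbf f(\mathbf u)+\mathbf c(\mathbf u)\partial_x\mathbf u=0$ with $\mathbf f(\mathbf u)=(0,\alpha_i\rho_iu_i,\alpha_i(\rho_iu_i^2+p_i),\alpha_iu_i(\rho_iE_i+p_i))^\top$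 and $\mathbf c(\mathbf u)\partial_x\mathbf u=\partial_x\alpha_i(u_I,0,-p_I,-p_Iu_I)^\top$, where $u_I=\beta u_1+(1-\beta)u_2$, $p_I=\mu p_1+(1-\mu)p_2$, $\beta=\frac{\chi\alpha_1\rho_1}{\chi\alpha_1\rho_1+(1-\chi)\alpha_2\rho_2}$, $\mu=\frac{(1-\beta)T_2}{\beta T_1+(1-\beta)T_2}$. **Entropy.** $s_i=-C_{v,i}(\ln\theta_i+(\gamma_i-1)\ln\rho_i)$, $\eta(\mathbf u)=-\sum_i\alpha_i\rho_is_i$, $q(\mathbf u)=-\sum_i\alpha_i\rho_iu_is_i$. The entropy variables are $\mathbf v(\mathbf u)=\eta'(\mathbf u)$ (gradient); explicitly, in the vector convention, $\mathbf v=\big((-1)^i(p_1\theta_1-p_2\theta_2),\ -s_i+(h_i-u_i^2/2)\theta_i,\ u_i\theta_i,\ -\theta_i\big)^\top$ with $h_i=e_i+p_i/\rho_i=\gamma_iC_{v,i}T_i$. **Means and jumps.** For a quantity $a$ with values $a^\pm$ at $\mathbf u^\pm$: $[\![a]\!]=a^+-a^-$, $\overline a=\frac{a^++a^-}2$, and for $a^\pm>0$ the logarithmic mean $\hat a=[\![a]\!]/[\![\ln a]\!]$, with $\hat a=a^-$ if $a^-=a^+$. **Definitions.** Fluxes $\mathbf D^\pm_{ec}:\Omega\times\Omega\to\mathbb R^7$ are consistent if $\mathbf D^\pm_{ec}(\mathbf u,\mathbf u)=0$, and entropy conservative if $\mathbf v(\mathbf u^-)^\top\mathbf D^-_{ec}(\mathbf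 u^-,\mathbf u^+)+\mathbf v(\mathbf u^+)^\top\mathbf D^+_{ec}(\mathbf u^-,\mathbf u^+)=q(\mathbf u^+)-q(\mathbf u^-)$ for all $\mathbf u^\pm\in\Omega$. Entropy stable fluxes are fluxes of the form $\mathbf D^\pm=\mathbf D^\pm_{ec}\pm\mathbf D_\nu$ with $\mathbf D_\nu(\mathbf u,\mathbf u)=0$ and $[\![\mathbf v(\mathbf u)]\!]^\top\mathbf D_\nu(\mathbf u^-,\mathbf u^+)\ge0$. *)

theory Defs
  imports "HOL-Analysis.Analysis"
begin

datatype phase = Ph1 | Ph2

record bn_params =
  Cv :: "phase \<Rightarrow> real"
  adiab :: "phase \<Rightarrow> real"   \<comment> \<open>the exponents \<open>\<gamma>\<^sub>i\<close>\<close>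
  pinf :: "phase \<Rightarrow> real"
  chi :: real

definition admissible_params :: "bn_params \<Rightarrow> bool" where
  "admissible_params P \<longleftrightarrow>
     (\<forall>i. Cv P i > 0 \<and> adiab P i > 1 \<and> pinf P i \<ge> 0) \<and> chi P \<in> {0, 1/2, 1}"

text \<open>
  A state is \<open>(\<alpha>\<^sub>1, \<alpha>\<^sub>1\<rho>\<^sub>1, \<alpha>\<^sub>1\<rho>\<^sub>1u\<^sub>1, \<alpha>\<^sub>1\<rho>\<^sub>1E\<^sub>1, \<alpha>\<^sub>2\<rho>\<^sub>2, \<alpha>\<^sub>2\<rho>\<^sub>2u\<^sub>2, \<alpha>\<^sub>2\<rho>\<^sub>2E\<^sub>2)\<close>; all other
  quantities are functions of these seven conserved variables.
\<close>

type_synonym state = "real ^ 7"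

fun void_frac :: "phase \<Rightarrow> state \<Rightarrow> real" where
  "void_frac Ph1 w = w $ 1"
| "void_frac Ph2 w = 1 - w $ 1"

fun part_mass :: "phase \<Rightarrow> state \<Rightarrow> real" where
  "part_mass Ph1 w = w $ 2"
| "part_mass Ph2 w = w $ 5"

fun part_mom :: "phase \<Rightarrow> state \<Rightarrow> real" where
  "part_mom Ph1 w = w $ 3"
| "part_mom Ph2 w = w $ 6"

fun part_energy :: "phase \<Rightarrow> state \<Rightarrow> real" where
  "part_energy Ph1 w = w $ 4"
| "part_energy Ph2 w = w $ 7"

definition dens :: "phase \<Rightarrow> state \<Rightarrow> real" where
  "dens i w = part_mass i w / void_frac i w"

definition vel :: "phase \<Rightarrow> state \<Rightarrow> real" where
  "vel i w = part_mom i w / part_mass i w"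

definition tot_energy :: "phase \<Rightarrow> state \<Rightarrow> real" where
  "tot_energy i w = part_energy i w / part_mass i w"

definition int_energy :: "phase \<Rightarrow> state \<Rightarrow> real" where
  "int_energy i w = tot_energy i w - (vel i w)\<^sup>2 / 2"

definition pressure :: "bn_params \<Rightarrow> phase \<Rightarrow> state \<Rightarrow> real" where
  "pressure P i w = (adiab P i - 1) * dens i w * int_energy i w - adiab P i * pinf P i"

text \<open>The defining relation \<open>\<rho>\<^sub>i e\<^sub>i = \<rho>\<^sub>i C\<^sub>v\<^sub>,\<^sub>i T\<^sub>i + p\<^sub>\<infinity>\<^sub>,\<^sub>i\<close>, solved for the temperature.\<close>

definition temp :: "bn_params \<Rightarrow> phase \<Rightarrow> state \<Rightarrow> real" where
  "temp P i w = (dens i w * int_energy i w - pinf P i) / (dens i w * Cv P i)"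

definition inv_temp :: "bn_params \<Rightarrow> phase \<Rightarrow> state \<Rightarrow> real" where
  "inv_temp P i w = 1 / temp P i w"

definition phase_space :: "bn_params \<Rightarrow> state set" where
  "phase_space P = {w. \<forall>i. 0 < void_frac i w \<and> void_frac i w < 1 \<and> dens i w > 0 \<and>
                          int_energy i w > 0 \<and> temp P i w > 0}"

text \<open>
  \<open>phase_vec a\<close> stacks two columns \<open>a i\<close> into one vector; the first line belongs to the void
  fraction equation, which is kept for phase 1 only.
\<close>

definition phase_vec :: "(phase \<Rightarrow> real ^ 4) \<Rightarrow> real ^ 7" where
  "phase_vec a = vector [a Ph1 $ 1, a Ph1 $ 2, a Ph1 $ 3, a Ph1 $ 4,
                         a Ph2 $ 2, a Ph2 $ 3, a Ph2 $ 4]"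

text \<open>
  The system \<open>\<partial>\<^sub>t w + \<partial>\<^sub>x f(w) + c(w) \<partial>\<^sub>x w = 0\<close>. It fixes the model, but the notions of
  fluctuation fluxes below refer to it only through its entropy pair.
\<close>

definition beta_I :: "bn_params \<Rightarrow> state \<Rightarrow> real" where
  "beta_I P w = chi P * part_mass Ph1 w / (chi P * part_mass Ph1 w + (1 - chi P) * part_mass Ph2 w)"

definition mu_I :: "bn_params \<Rightarrow> state \<Rightarrow> real" where
  "mu_I P w = (1 - beta_I P w) * temp P Ph2 w /
              (beta_I P w * temp P Ph1 w + (1 - beta_I P w) * temp P Ph2 w)"

definition vel_I :: "bn_params \<Rightarrow> state \<Rightarrow> real" where
  "vel_I P w = beta_I P w * vel Ph1 w + (1 - beta_I P w) * vel Ph2 w"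

definition pressure_I :: "bn_params \<Rightarrow> state \<Rightarrow> real" where
  "pressure_I P w = mu_I P w * pressure P Ph1 w + (1 - mu_I P w) * pressure P Ph2 w"

definition bn_flux :: "bn_params \<Rightarrow> state \<Rightarrow> real ^ 7" where
  "bn_flux P w = phase_vec (\<lambda>i. vector
     [0,
      void_frac i w * dens i w * vel i w,
      void_frac i w * (dens i w * (vel i w)\<^sup>2 + pressure P i w),
      void_frac i w * vel i w * (dens i w * tot_energy i w + pressure P i w)])"

text \<open>\<open>bn_noncons P w z\<close> is \<open>c(w) z\<close>, where \<open>\<partial>\<^sub>x\<alpha>\<^sub>2 = - \<partial>\<^sub>x\<alpha>\<^sub>1\<close>.\<close>

definition bn_noncons :: "bn_params \<Rightarrow> state \<Rightarrow> real ^ 7 \<Rightarrow> real ^ 7" where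
  "bn_noncons P w z = phase_vec (\<lambda>i. (case i of Ph1 \<Rightarrow> z $ 1 | Ph2 \<Rightarrow> - (z $ 1)) *\<^sub>R
     vector [vel_I P w, 0, - pressure_I P w, - (pressure_I P w * vel_I P w)])"

definition spec_entropy :: "bn_params \<Rightarrow> phase \<Rightarrow> state \<Rightarrow> real" where
  "spec_entropy P i w = - Cv P i * (ln (inv_temp P i w) + (adiab P i - 1) * ln (dens i w))"

definition entropy :: "bn_params \<Rightarrow> state \<Rightarrow> real" where
  "entropy P w = - (\<Sum>i\<in>{Ph1, Ph2}. void_frac i w * dens i w * spec_entropy P i w)"

definition entropy_flux :: "bn_params \<Rightarrow> state \<Rightarrow> real" where
  "entropy_flux P w = - (\<Sum>i\<in>{Ph1, Ph2}. void_frac i w * dens i w * vel i w * spec_entropy P i w)"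

definition entropy_vars :: "bn_params \<Rightarrow> state \<Rightarrow> real ^ 7" where
  "entropy_vars P w = (THE v. GDERIV (entropy P) w :> v)"

definition jump :: "('s \<Rightarrow> 'b::ab_group_add) \<Rightarrow> 's \<Rightarrow> 's \<Rightarrow> 'b" where
  "jump a um up = a up - a um"

definition amean :: "('s \<Rightarrow> real) \<Rightarrow> 's \<Rightarrow> 's \<Rightarrow> real" where
  "amean a um up = (a up + a um) / 2"

definition logmean :: "('s \<Rightarrow> real) \<Rightarrow> 's \<Rightarrow> 's \<Rightarrow> real" where
  "logmean a um up = (if a um = a up then a um else jump a um up / jump (\<lambda>w. ln (a w)) um up)"

text \<open>Two-point fluxes take the left state first; only their values on the phase space matter.\<close>

type_synonym two_point_flux = "state \<Rightarrow> state \<Rightarrow> real ^ 7"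

definition consistent_fluxes :: "bn_params \<Rightarrow> two_point_flux \<Rightarrow> two_point_flux \<Rightarrow> bool" where
  "consistent_fluxes P Dm Dp \<longleftrightarrow> (\<forall>w\<in>phase_space P. Dm w w = 0 \<and> Dp w w = 0)"

definition entropy_conservative :: "bn_params \<Rightarrow> two_point_flux \<Rightarrow> two_point_flux \<Rightarrow> bool" where
  "entropy_conservative P Dm Dp \<longleftrightarrow> (\<forall>um\<in>phase_space P. \<forall>up\<in>phase_space P.
     entropy_vars P um \<bullet> Dm um up + entropy_vars P up \<bullet> Dp um up
       = entropy_flux P up - entropy_flux P um)"

definition entropy_stable :: "bn_params \<Rightarrow> two_point_flux \<Rightarrow> two_point_flux \<Rightarrow> bool" where
  "entropy_stable P Dm Dp \<longleftrightarrow> (\<exists>Ecm Ecp Dnu.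
     consistent_fluxes P Ecm Ecp \<and> entropy_conservative P Ecm Ecp \<and>
     (\<forall>w\<in>phase_space P. Dnu w w = 0) \<and>
     (\<forall>um\<in>phase_space P. \<forall>up\<in>phase_space P.
        jump (entropy_vars P) um up \<bullet> Dnu um up \<ge> 0 \<and>
        Dm um up = Ecm um up - Dnu um up \<and> Dp um up = Ecp um up + Dnu um up))"

type_synonym coeff = "phase \<Rightarrow> state \<Rightarrow> state \<Rightarrow> real"

definition dissipation ::
    "bn_params \<Rightarrow> coeff \<Rightarrow> coeff \<Rightarrow> coeff \<Rightarrow> coeff \<Rightarrow> coeff \<Rightarrow> coeff \<Rightarrow> two_point_flux" where
  "dissipation P k22 k32 k33 k42 k43 k44 um up = phase_vec (\<lambda>i.
     (vector [vector [0, 0, 0, 0],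
              vector [0, k22 i um up, 0, 0],
              vector [0, k32 i um up, k33 i um up, 0],
              vector [0, k42 i um up, k43 i um up, k44 i um up]] :: real ^ 4 ^ 4) *v
     vector [0, jump (dens i) um up, jump (vel i) um up, jump (temp P i) um up])"

end

theory Submission
  imports Defs
begin

text \<open>
  Gibbs' relation gives the entropy variables explicitly. The void fraction component of \<open>D\<^sub>\<nu>\<close>
  vanishes, so the entropy dissipation splits into one term per phase. The logarithmic mean turns
  \<open>\<lbrakk>ln \<theta>\<rbrakk>\<close> into \<open>\<lbrakk>\<theta>\<rbrakk> / logmean(\<theta>)\<close>, and the off-diagonal coefficients are exactly those for which the term
  of each phase collapses to
  \<open>C\<^sub>v (\<gamma> - 1) k\<^sub>2\<^sub>2 \<lbrakk>ln \<rho>\<rbrakk> \<lbrakk>\<rho>\<rbrakk> + k\<^sub>3\<^sub>3 mean(\<theta>) \<lbrakk>u\<rbrakk>\<^sup>2 - k\<^sub>4\<^sub>4 \<lbrakk>\<theta>\<rbrakk> \<lbrakk>T\<rbrakk>\<close>, where \<open>\<theta> = 1 / T\<close>.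
\<close>

section \<open>Coordinates of the stacked vectors\<close>

lemma UNIV_7: "(UNIV :: 7 set) = {1, 2, 3, 4, 5, 6, 7}"
proof -
  have "card {1, 2, 3, 4, 5, 6, 7 :: 7} = 7" by simp
  then show ?thesis
    by (intro card_subset_eq[symmetric]) auto
qed

lemma forall_7: "(\<forall>i::7. Q i) \<longleftrightarrow> Q 1 \<and> Q 2 \<and> Q 3 \<and> Q 4 \<and> Q 5 \<and> Q 6 \<and> Q 7"
proof -
  have "(\<forall>i\<in>UNIV :: 7 set. Q i) \<longleftrightarrow> Q 1 \<and> Q 2 \<and> Q 3 \<and> Q 4 \<and> Q 5 \<and> Q 6 \<and> Q 7"
    unfolding UNIV_7 by simp
  then show ?thesis by simp
qed

lemma sum_7: "sum f (UNIV :: 7 set) = f 1 + f 2 + f 3 + f 4 + f 5 + f 6 + f 7"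
  unfolding UNIV_7 by (simp add: ac_simps)

lemma vector_7:
  fixes a :: "'a::zero"
  shows "(vector [a, b, c, d, e, f, g] :: 'a ^ 7) $ 1 = a"
    "(vector [a, b, c, d, e, f, g] :: 'a ^ 7) $ 2 = b"
    "(vector [a, b, c, d, e, f, g] :: 'a ^ 7) $ 3 = c"
    "(vector [a, b, c, d, e, f, g] :: 'a ^ 7) $ 4 = d"
    "(vector [a, b, c, d, e, f, g] :: 'a ^ 7) $ 5 = e"
    "(vector [a, b, c, d, e, f, g] :: 'a ^ 7) $ 6 = f"
    "(vector [a, b, c, d, e, f, g] :: 'a ^ 7) $ 7 = g"
  unfolding vector_def by simp_all

lemma vector_4:
  fixes a :: "'a::zero"
  shows "(vector [a, b, c, d] :: 'a ^ 4) $ 1 = a"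
    "(vector [a, b, c, d] :: 'a ^ 4) $ 2 = b"
    "(vector [a, b, c, d] :: 'a ^ 4) $ 3 = c"
    "(vector [a, b, c, d] :: 'a ^ 4) $ 4 = d"
  unfolding vector_def by simp_all

text \<open>The coordinate maps \<open>part_mass\<close>, \<open>part_mom\<close>,
  \<open>part_energy\<close> make sense for any vector, so this serves both increments
  \<open>h\<close> and jumps of entropy variables.\<close>

lemma inner_phase_vec:
  "w \<bullet> phase_vec a = w $ 1 * a Ph1 $ 1 +
     (\<Sum>i\<in>{Ph1, Ph2}. part_mass i w * a i $ 2 + part_mom i w * a i $ 3 + part_energy i w * a i $ 4)"
  by (simp add: phase_vec_def inner_vec_def sum_7 vector_7)

section \<open>Derivatives of the primitive variables and of the specific entropy\<close>

fun dvoid_frac :: "phase \<Rightarrow> state \<Rightarrow> real" where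
  "dvoid_frac Ph1 h = h $ 1"
| "dvoid_frac Ph2 h = - h $ 1"

lemma has_derivative_void_frac: "(void_frac i has_derivative dvoid_frac i) (at w)"
proof (cases i)
  case Ph1
  have "((\<lambda>w :: state. w $ 1) has_derivative (\<lambda>h. h $ 1)) (at w)"
    by (intro bounded_linear_imp_has_derivative bounded_linear_vec_nth)
  moreover have "void_frac Ph1 = (\<lambda>w. w $ 1)" "dvoid_frac Ph1 = (\<lambda>h. h $ 1)"
    by auto
  ultimately show ?thesis
    by (simp add: Ph1)
next
  case Ph2
  have "((\<lambda>w :: state. 1 - w $ 1) has_derivative (\<lambda>h. 0 - h $ 1)) (at w)"
    by (intro has_derivative_diff has_derivative_const bounded_linear_imp_has_derivative
        bounded_linear_vec_nth)
  moreover have "void_frac Ph2 = (\<lambda>w. 1 - w $ 1)" "dvoid_frac Ph2 = (\<lambda>h. 0 - h $ 1)"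
    by auto
  ultimately show ?thesis
    by (simp add: Ph2)
qed

text \<open>Each map is a coordinate projection, hence bounded linear and its own derivative;
  \<open>void_frac Ph2\<close> is only affine and needs \<open>dvoid_frac\<close>.\<close>

lemma has_derivative_part:
  "(part_mass i has_derivative part_mass i) F"
  "(part_mom i has_derivative part_mom i) F"
  "(part_energy i has_derivative part_energy i) F"
proof -
  have mass: "part_mass i = (\<lambda>w. w $ (case i of Ph1 \<Rightarrow> 2 | Ph2 \<Rightarrow> 5))"
    by (cases i) (simp_all add: fun_eq_iff)
  have mom: "part_mom i = (\<lambda>w. w $ (case i of Ph1 \<Rightarrow> 3 | Ph2 \<Rightarrow> 6))"
    by (cases i) (simp_all add: fun_eq_iff)
  have energy: "part_energy i = (\<lambda>w. w $ (case i of Ph1 \<Rightarrow> 4 | Ph2 \<Rightarrow> 7))"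
    by (cases i) (simp_all add: fun_eq_iff)
  show "(part_mass i has_derivative part_mass i) F"
    unfolding mass by (rule bounded_linear_imp_has_derivative[OF bounded_linear_vec_nth])
  show "(part_mom i has_derivative part_mom i) F"
    unfolding mom by (rule bounded_linear_imp_has_derivative[OF bounded_linear_vec_nth])
  show "(part_energy i has_derivative part_energy i) F"
    unfolding energy by (rule bounded_linear_imp_has_derivative[OF bounded_linear_vec_nth])
qed

lemma has_derivative_dens:
  assumes "void_frac i w \<noteq> 0"
  shows "(dens i has_derivative (\<lambda>h. (part_mass i h - dens i w * dvoid_frac i h) / void_frac i w)) (at w)"
  unfolding dens_def [abs_def]
  by (rule has_derivative_eq_rhs, rule has_derivative_divide'[OF has_derivative_part(1) has_derivative_void_frac])
    (use assms in \<open>auto simp: fun_eq_iff field_simps\<close>)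

lemma has_derivative_vel:
  assumes "part_mass i w \<noteq> 0"
  shows "(vel i has_derivative (\<lambda>h. (part_mom i h - vel i w * part_mass i h) / part_mass i w)) (at w)"
  unfolding vel_def [abs_def]
  by (rule has_derivative_eq_rhs, rule has_derivative_divide'[OF has_derivative_part(2,1)])
    (use assms in \<open>auto simp: fun_eq_iff field_simps\<close>)

lemma has_derivative_tot_energy:
  assumes "part_mass i w \<noteq> 0"
  shows "(tot_energy i has_derivative
    (\<lambda>h. (part_energy i h - tot_energy i w * part_mass i h) / part_mass i w)) (at w)"
  unfolding tot_energy_def [abs_def]
  by (rule has_derivative_eq_rhs, rule has_derivative_divide'[OF has_derivative_part(3,1)])
    (use assms in \<open>auto simp: fun_eq_iff field_simps\<close>)

text \<open>From \<open>de = dE - u du\<close>; the factor \<open>u^2 - E\<close> of the mass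
  increment collects the quotient rule terms of both \<open>E\<close> and \<open>u\<close>.\<close>

lemma has_derivative_int_energy:
  assumes "part_mass i w \<noteq> 0"
  shows "(int_energy i has_derivative
    (\<lambda>h. (part_energy i h - vel i w * part_mom i h
          + ((vel i w)\<^sup>2 - tot_energy i w) * part_mass i h) / part_mass i w)) (at w)"
  unfolding int_energy_def [abs_def]
  by (rule has_derivative_eq_rhs,
      (rule derivative_intros has_derivative_tot_energy has_derivative_vel assms)+)
    (use assms in \<open>auto simp: fun_eq_iff field_simps power2_eq_square\<close>)

text \<open>Differentiates \<open>C\<^sub>v T = e - p\<^sub>\<infinity> / \<rho>\<close>. Keeping
  \<open>r\<close> and \<open>e\<close> abstract lets Gibbs' relation appear before conserved
  variables enter.\<close>

lemma has_derivative_temp: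
  assumes "(dens i has_derivative r) (at w)" "(int_energy i has_derivative e) (at w)"
    and "dens i w \<noteq> 0" "Cv P i \<noteq> 0"
  shows "(temp P i has_derivative (\<lambda>h. (e h + pinf P i / (dens i w)\<^sup>2 * r h) / Cv P i)) (at w)"
  unfolding temp_def [abs_def]
  by (rule has_derivative_eq_rhs, rule has_derivative_divide',
      (rule derivative_intros assms)+)
    (use assms in \<open>auto simp: fun_eq_iff field_simps power2_eq_square\<close>)

text \<open>Gibbs' relation \<open>T ds = de - (p / \<rho>\<^sup>2) d\<rho>\<close>.\<close>

lemma has_derivative_spec_entropy:
  assumes r: "(dens i has_derivative r) (at w)" and e: "(int_energy i has_derivative e) (at w)"
    and pos: "dens i w > 0" "Cv P i > 0" "temp P i w > 0"
  shows "(spec_entropy P i has_derivative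
    (\<lambda>h. inv_temp P i w * (e h - pressure P i w / (dens i w)\<^sup>2 * r h))) (at w)"
proof -
  \<comment> \<open>In this form the \<open>p\<^sub>\<infinity>\<close> term from \<open>dT\<close>
    and the term from \<open>ln \<rho>\<close> add up to the pressure.\<close>
  have p: "pressure P i w = (adiab P i - 1) * dens i w * Cv P i * temp P i w - pinf P i"
    using pos by (simp add: pressure_def temp_def field_simps)
  have T: "(temp P i has_derivative (\<lambda>h. (e h + pinf P i / (dens i w)\<^sup>2 * r h) / Cv P i)) (at w)"
    using has_derivative_temp[OF r e] pos by simp
  have "((\<lambda>w. - Cv P i * (ln (1 / temp P i w) + (adiab P i - 1) * ln (dens i w))) has_derivative
      (\<lambda>h. Cv P i * ((e h + pinf P i / (dens i w)\<^sup>2 * r h) / Cv P i / temp P i w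
        - (adiab P i - 1) * r h / dens i w))) (at w)"
    using pos by (auto intro!: derivative_eq_intros T r simp: fun_eq_iff field_simps power2_eq_square)
  moreover have "Cv P i * ((e h + pinf P i / (dens i w)\<^sup>2 * r h) / Cv P i / temp P i w
        - (adiab P i - 1) * r h / dens i w)
      = inv_temp P i w * (e h - pressure P i w / (dens i w)\<^sup>2 * r h)" for h
    unfolding p inv_temp_def using pos by (simp add: field_simps power2_eq_square)
  ultimately show ?thesis
    unfolding spec_entropy_def [abs_def] inv_temp_def by simp
qed

section \<open>The entropy variables as gradient of the entropy\<close>

lemma phase_enthalpy:
  assumes "dens i w \<noteq> 0" "Cv P i \<noteq> 0"
  shows "int_energy i w + pressure P i w / dens i w = adiab P i * Cv P i * temp P i w"
  using assms by (simp add: pressure_def temp_def field_simps)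

text \<open>Product rule and Gibbs' relation. The factor \<open>p \<theta>\<close> of the void
  fraction increment arises because \<open>\<rho>\<close> is partial mass over void
  fraction.\<close>

lemma has_derivative_phase_entropy:
  assumes pos: "void_frac i w > 0" "dens i w > 0" "Cv P i > 0" "temp P i w > 0"
  shows "((\<lambda>w. void_frac i w * dens i w * spec_entropy P i w) has_derivative
    (\<lambda>h. pressure P i w * inv_temp P i w * dvoid_frac i h
       - part_mass i h * (- spec_entropy P i w + adiab P i * Cv P i - (vel i w)\<^sup>2 / 2 * inv_temp P i w)
       - part_mom i h * (vel i w * inv_temp P i w) + part_energy i h * inv_temp P i w)) (at w)"
proof -
  have m: "part_mass i w = void_frac i w * dens i w"
    using pos by (simp add: dens_def)
  have m0: "part_mass i w \<noteq> 0" "void_frac i w \<noteq> 0" using pos m by auto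
  note r = has_derivative_dens[OF m0(2)] and e = has_derivative_int_energy[OF m0(1)]
  \<comment> \<open>Eliminating \<open>E\<close> turns the mass coefficient into its enthalpy form,
    where \<open>h \<theta> = \<gamma> C\<^sub>v\<close>.\<close>
  have E: "tot_energy i w = adiab P i * Cv P i * temp P i w - pressure P i w / dens i w + (vel i w)\<^sup>2 / 2"
    using phase_enthalpy[of i w P] pos by (simp add: int_energy_def)
  show ?thesis
    by (rule has_derivative_eq_rhs,
        (rule has_derivative_mult has_derivative_void_frac r
          has_derivative_spec_entropy[OF r e pos(2-4)])+)
      (use pos in \<open>simp add: fun_eq_iff E m inv_temp_def field_simps power2_eq_square\<close>)
qed

text \<open>In the second component, \<open>\<gamma> C\<^sub>v\<close> is the constant \<open>h \<theta>\<close> (\<open>phase_enthalpy\<close>).\<close>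

definition phase_entropy_vars :: "bn_params \<Rightarrow> phase \<Rightarrow> state \<Rightarrow> real ^ 4" where
  "phase_entropy_vars P i w = vector
     [(case i of Ph1 \<Rightarrow> - 1 | Ph2 \<Rightarrow> 1)
        * (pressure P Ph1 w * inv_temp P Ph1 w - pressure P Ph2 w * inv_temp P Ph2 w),
      - spec_entropy P i w + adiab P i * Cv P i - (vel i w)\<^sup>2 / 2 * inv_temp P i w,
      vel i w * inv_temp P i w,
      - inv_temp P i w]"

lemma phase_entropy_vars_nth:
  "phase_entropy_vars P Ph1 w $ 1
    = pressure P Ph2 w * inv_temp P Ph2 w - pressure P Ph1 w * inv_temp P Ph1 w"
  "phase_entropy_vars P i w $ 2
    = - spec_entropy P i w + adiab P i * Cv P i - (vel i w)\<^sup>2 / 2 * inv_temp P i w"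
  "phase_entropy_vars P i w $ 3 = vel i w * inv_temp P i w"
  "phase_entropy_vars P i w $ 4 = - inv_temp P i w"
  by (simp_all add: phase_entropy_vars_def vector_4)

text \<open>Since \<open>dvoid_frac\<close> has opposite signs in the two phases, their
  \<open>p \<theta>\<close> terms merge into the difference in the first component.\<close>

lemma entropy_vars_eq:
  assumes "admissible_params P" "w \<in> phase_space P"
  shows "entropy_vars P w = phase_vec (\<lambda>i. phase_entropy_vars P i w)"
proof -
  have D: "GDERIV (entropy P) w :> phase_vec (\<lambda>i. phase_entropy_vars P i w)"
    unfolding gderiv_def entropy_def [abs_def]
    by (rule has_derivative_eq_rhs, (rule has_derivative_minus has_derivative_sum has_derivative_phase_entropy)+)
      (use assms in \<open>auto simp: admissible_params_def phase_space_def fun_eq_iff inner_phase_vec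
        phase_entropy_vars_nth algebra_simps\<close>)
  \<comment> \<open>\<open>entropy_vars\<close> is a definite description, so uniqueness of the
    gradient is required as well.\<close>
  have "v = phase_vec (\<lambda>i. phase_entropy_vars P i w)" if "GDERIV (entropy P) w :> v" for v
  proof -
    have "(\<lambda>h. h \<bullet> v) = (\<lambda>h. h \<bullet> phase_vec (\<lambda>i. phase_entropy_vars P i w))"
      using that D unfolding gderiv_def by (rule has_derivative_unique)
    then show ?thesis
      unfolding fun_eq_iff by (simp add: vector_eq_ldot)
  qed
  with D show ?thesis
    unfolding entropy_vars_def by (intro the_equality)
qed

section \<open>Sign of the dissipation\<close>

lemma part_phase_vec:
  "part_mass i (phase_vec a) = a i $ 2"
  "part_mom i (phase_vec a) = a i $ 3"
  "part_energy i (phase_vec a) = a i $ 4"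
  by (cases i; simp add: phase_vec_def vector_7)+

text \<open>In the \<open>k22\<close> part the velocity terms cancel, since \<open>mean(u)
  [u \<theta>] - [u^2 \<theta>] / 2 = um up [\<theta>] / 2\<close> for jumps \<open>[.]\<close>, and
  \<open>c / L\<close> cancels \<open>c [ln \<theta>]\<close>. In the \<open>k33\<close> part,
  \<open>[u \<theta>] - mean(u) [\<theta>] = mean(\<theta>) [u]\<close>. The three remaining terms
  are nonnegative because \<open>ln\<close> increases and \<open>1 / \<theta>\<close>
  decreases.\<close>

lemma phase_dissipation_nonneg:
  fixes \<rho>m \<rho>p um up \<theta>m \<theta>p Tm Tp c \<gamma> :: real
  assumes pos: "\<rho>m > 0" "\<rho>p > 0" "\<theta>m > 0" "\<theta>p > 0" "c > 0" "\<gamma> > 1"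
    and k: "k22 \<ge> 0" "k33 \<ge> 0" "k44 \<ge> 0"
    and T: "Tm = 1 / \<theta>m" "Tp = 1 / \<theta>p"
    and L: "L * (ln \<theta>p - ln \<theta>m) = \<theta>p - \<theta>m" "L \<noteq> 0"
  shows "0 \<le> (c * (ln \<theta>p + (\<gamma> - 1) * ln \<rho>p) - up\<^sup>2 / 2 * \<theta>p
              - (c * (ln \<theta>m + (\<gamma> - 1) * ln \<rho>m) - um\<^sup>2 / 2 * \<theta>m)) * (k22 * (\<rho>p - \<rho>m))
      + (up * \<theta>p - um * \<theta>m) * ((up + um) / 2 * k22 * (\<rho>p - \<rho>m) + k33 * (up - um))
      + (\<theta>m - \<theta>p) * ((c / L + um * up / 2) * k22 * (\<rho>p - \<rho>m)
                        + (up + um) / 2 * k33 * (up - um) + k44 * (Tp - Tm))" (is "0 \<le> ?D")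
proof -
  have ln: "ln \<theta>p = ln \<theta>m + (\<theta>p - \<theta>m) / L"
    using L by (simp add: field_simps)
  have "?D = c * (\<gamma> - 1) * k22 * ((ln \<rho>p - ln \<rho>m) * (\<rho>p - \<rho>m))
      + k33 * ((\<theta>p + \<theta>m) / 2 * (up - um)\<^sup>2) + k44 * ((\<theta>m - \<theta>p) * (Tp - Tm))"
    unfolding ln using L(2) by (simp add: field_simps power2_eq_square)
  moreover have "(ln \<rho>p - ln \<rho>m) * (\<rho>p - \<rho>m) \<ge> 0"
    using pos by (auto simp: zero_le_mult_iff)
  moreover have "(\<theta>m - \<theta>p) * (Tp - Tm) \<ge> 0"
  proof -
    have "(\<theta>m - \<theta>p) * (Tp - Tm) = (\<theta>m - \<theta>p)\<^sup>2 / (\<theta>m * \<theta>p)"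
      using pos by (simp add: T field_simps power2_eq_square)
    then show ?thesis using pos by simp
  qed
  ultimately show ?thesis
    using pos k by simp
qed

text \<open>The product form also covers equal values, where both sides vanish, so no case split is
  left for the dissipation estimate.\<close>

lemma logmean_ln_jump:
  assumes "a um > 0" "a up > 0"
  shows "logmean a um up * (ln (a up) - ln (a um)) = a up - a um"
  using assms by (auto simp: logmean_def jump_def)

text \<open>For distinct values the numerator and, by injectivity of \<open>ln\<close>, the
  denominator are nonzero; for equal values the mean is that positive value.\<close>

lemma logmean_nonzero:
  assumes "a um > 0" "a up > 0"
  shows "logmean a um up \<noteq> 0"
  using assms by (auto simp: logmean_def jump_def)

theorem proposition4p2:
  fixes P :: bn_params
    and Dm Dp :: two_point_flux
    and k22 k32 k33 k42 k43 k44 :: coeff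
  assumes params: "admissible_params P"
    and consistent: "consistent_fluxes P Dm Dp"
    and conservative: "entropy_conservative P Dm Dp"
    and coeffs: "\<And>i um up. um \<in> phase_space P \<Longrightarrow> up \<in> phase_space P \<Longrightarrow>
          k22 i um up \<ge> 0 \<and> k33 i um up \<ge> 0 \<and> k44 i um up \<ge> 0 \<and>
          k32 i um up = amean (vel i) um up * k22 i um up \<and>
          k43 i um up = amean (vel i) um up * k33 i um up \<and>
          k42 i um up = (Cv P i / logmean (inv_temp P i) um up + vel i um * vel i up / 2) * k22 i um up"
  defines "Dnu \<equiv> dissipation P k22 k32 k33 k42 k43 k44"
  shows "(\<forall>w\<in>phase_space P. Dnu w w = 0) \<and>
         (\<forall>um\<in>phase_space P. \<forall>up\<in>phase_space P.
            jump (entropy_vars P) um up \<bullet> Dnu um up \<ge> 0) \<and>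
         entropy_stable P (\<lambda>um up. Dm um up - Dnu um up) (\<lambda>um up. Dp um up + Dnu um up)"
proof -
  note Dnu = Dnu_def dissipation_def
  have zero: "Dnu w w = 0" for w
    by (simp add: Dnu phase_vec_def jump_def vec_eq_iff forall_7 vector_7 vector_4
        matrix_vector_mult_def sum_4)
  have nonneg: "jump (entropy_vars P) um up \<bullet> Dnu um up \<ge> 0"
    if um: "um \<in> phase_space P" and up: "up \<in> phase_space P" for um up
  proof -
    \<comment> \<open>The matrix product of each phase, multiplied out.\<close>
    define d :: "phase \<Rightarrow> real ^ 4" where "d i = vector
      [0, k22 i um up * (dens i up - dens i um),
       k32 i um up * (dens i up - dens i um) + k33 i um up * (vel i up - vel i um),
       k42 i um up * (dens i up - dens i um) + k43 i um up * (vel i up - vel i um)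
         + k44 i um up * (temp P i up - temp P i um)]" for i
    have d: "Dnu um up = phase_vec d"
      unfolding Dnu by (intro arg_cong[where f = phase_vec] ext)
        (simp add: d_def vec_eq_iff forall_4 vector_4 matrix_vector_mult_def sum_4 jump_def)
    have d1: "d i $ 1 = 0" for i
      by (simp add: d_def vector_4)
    have phase: "(phase_entropy_vars P i up - phase_entropy_vars P i um) $ 2 * d i $ 2
        + (phase_entropy_vars P i up - phase_entropy_vars P i um) $ 3 * d i $ 3
        + (phase_entropy_vars P i up - phase_entropy_vars P i um) $ 4 * d i $ 4 \<ge> 0" for i
    proof -
      have pos: "dens i um > 0" "dens i up > 0" "inv_temp P i um > 0" "inv_temp P i up > 0"
        "Cv P i > 0" "adiab P i > 1"
        using params um up by (auto simp: admissible_params_def phase_space_def inv_temp_def)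
      have T: "temp P i um = 1 / inv_temp P i um" "temp P i up = 1 / inv_temp P i up"
        by (simp_all add: inv_temp_def)
      have k: "k22 i um up \<ge> 0" "k33 i um up \<ge> 0" "k44 i um up \<ge> 0"
        and c: "k32 i um up = (vel i up + vel i um) / 2 * k22 i um up"
          "k43 i um up = (vel i up + vel i um) / 2 * k33 i um up"
          "k42 i um up
            = (Cv P i / logmean (inv_temp P i) um up + vel i um * vel i up / 2) * k22 i um up"
        using coeffs[OF um up, of i] by (simp_all add: amean_def)
      show ?thesis
        unfolding d_def vector_4 c vector_minus_component phase_entropy_vars_nth spec_entropy_def
        \<comment> \<open>The constant \<open>\<gamma> C\<^sub>v\<close> in the second entropy
          variable drops out of the jump.\<close>
        by (rule order_trans[OF phase_dissipation_nonneg[OF pos k T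
              logmean_ln_jump[of "inv_temp P i", OF pos(3,4)]
              logmean_nonzero[of "inv_temp P i", OF pos(3,4)], of "vel i up" "vel i um"]])
          (simp add: algebra_simps)
    qed
    \<comment> \<open>The first entropy variable, the only one coupling the phases, meets the zero
      entry \<open>d1\<close>.\<close>
    have "jump (entropy_vars P) um up \<bullet> Dnu um up
      = (\<Sum>i\<in>{Ph1, Ph2}. (phase_entropy_vars P i up - phase_entropy_vars P i um) $ 2 * d i $ 2
        + (phase_entropy_vars P i up - phase_entropy_vars P i um) $ 3 * d i $ 3
        + (phase_entropy_vars P i up - phase_entropy_vars P i um) $ 4 * d i $ 4)"
      unfolding jump_def d inner_diff_left entropy_vars_eq[OF params um] entropy_vars_eq[OF params up]
      unfolding inner_phase_vec part_phase_vec
      by (simp add: d1 algebra_simps)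
    also have "\<dots> \<ge> 0"
      by (intro sum_nonneg phase)
    finally show ?thesis .
  qed
  have "entropy_stable P (\<lambda>um up. Dm um up - Dnu um up) (\<lambda>um up. Dp um up + Dnu um up)"
    unfolding entropy_stable_def using consistent conservative zero nonneg by blast
  with zero nonneg show ?thesis by blast
qed

end
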